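(* Suppose that $\hat{\Sigma}_x[i,j]\neq 0$ for all $i,j\in\{0,\ldots,L-1\}$. If $r=L$, then $\hat{\Sigma}_x$ cannot be recovered from only $P_y$ and $T_y$; that is, there exists a Hermitian and positive definite matrix $X\in\mathbb{C}^{L\times L}$ with $X\notin\Omega(\hat{\Sigma}_x)$ which satisfies $P_y=\mathcal{P}(X)$ and $T_y=\mathcal{T}(X)$.
   Context: All indices are in $\{0,\ldots,L-1\}$ and are taken modulo $L$. $\overline{(\cdot)}$ is complex conjugation, $(\cdot)^*$ is conjugate transpose. Model (complex-valued, noiseless). $x=\sum_{i=1}^r a_i v_i\in\mathbb{C}^L$, where $v_1,\ldots,v_r\in\mathbb{C}^L$ are orthonormal, $a_1,\ldots,a_r$ are independent, $a_i\sim\mathbb{C}\mathcal{N}(0,\lambda_i)$ (circularly-symmetric complex normal with variance $\lambda_i>0$). The observation is $y=R_s\{x\}$, where $R_s\{x\}[\ell]=x[\ell-s]$ is the cyclic shift and $s$ is a random element of $\mathbb{Z}_L$ with an arbitrary distribution, independent of $x$. Let $f_\ell\in\mathbb{C}^L$, $f_\ell[k]=e^{-\imath 2\pi k\ell/L}$, let $F[\ell,k]=\frac{1}{\sqrt{L}}f_\ell[k]$ be the unitary DFT matrix, $\hat{x}=Fx$, $\hat{y}=Fy$, $\hat{v}_i=Fv_i$, and $\hat{\Sigma}_x=\mathbb{E}[\hat{x}\hat{x}^*]=\sum_{i=1}^r\lambda_i\hat{v}_i\hat{v}_i^*$ (Hermitian, positive semidefinite, rank $r$). Power spectrum and trispectrum: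 $P_y[k]=\mathbb{E}\big[\hat{y}[k]\overline{\hat{y}[k]}\big]$ and $T_y[k_1,k_2,k_3]=\mathbb{E}\big[\hat{y}[k_1]\overline{\hat{y}[k_2]}\hat{y}[k_3]\overline{\hat{y}[k_1-k_2+k_3]}\big]$. Maps on $X\in\mathbb{C}^{L\times L}$: $\mathcal{P}(X)[k_1]=X[k_1,k_1]$ and $\mathcal{T}(X)[k_1,k_2,k_3]=X[k_1,k_2]\,\overline{X[k_3-k_2+k_1,k_3]}+X[k_1,k_3-k_2+k_1]\,\overline{X[k_2,k_3]}$. Ambiguity set: $\Omega(\hat{\Sigma}_x)=\{\operatorname{diag}(f_\ell)\,\hat{\Sigma}_x\,\operatorname{diag}(f_\ell^* ):\ \ell=0,\ldots,L-1\}$.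
   Formalization: The formal statement adds the assumption L ≥ 3; for L = 1 and L = 2 the claim is false, since P_y and T_y then determine every Hermitian X up to an element of the ambiguity set Ω(Σ̂_x). *)

theory Defs
  imports
    "HOL-Probability.Probability"
    "Jordan_Normal_Form.Schur_Decomposition"
begin

unbundle no vec_syntax
no_notation inner (infix "\<bullet>" 70)

text \<open>Vectors and matrices are those of \<^theory>\<open>Jordan_Normal_Form.Matrix\<close>, with indices
  \<open>0, \<dots>, L - 1\<close>.\<close>

definition zmod_index :: "nat \<Rightarrow> int \<Rightarrow> nat" where
  "zmod_index L i = nat (i mod int L)"

definition fourier_vec :: "nat \<Rightarrow> nat \<Rightarrow> complex vec" where
  "fourier_vec L l =
     Matrix.vec L (\<lambda>k. exp (- (\<i> * (2 * complex_of_real pi * of_nat k * of_nat l / of_nat L))))"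

definition dft_mat :: "nat \<Rightarrow> complex mat" where
  "dft_mat L = Matrix.mat L L (\<lambda>(l, k). 1 / complex_of_real (sqrt (real L)) * fourier_vec L l $ k)"

definition cyclic_shift :: "nat \<Rightarrow> nat \<Rightarrow> complex vec \<Rightarrow> complex vec" where
  "cyclic_shift L s x = Matrix.vec L (\<lambda>l. x $ zmod_index L (int l - int s))"

definition orthonormal_vecs :: "nat \<Rightarrow> nat \<Rightarrow> (nat \<Rightarrow> complex vec) \<Rightarrow> bool" where
  "orthonormal_vecs L r v \<longleftrightarrow>
     (\<forall>i<r. v i \<in> carrier_vec L) \<and>
     (\<forall>i<r. \<forall>j<r. v i \<bullet>c v j = (if i = j then 1 else 0))"

text \<open>The law \<open>CN(0, \<sigma>)\<close>: real and imaginary part are independent centred normal variables, each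
  of variance \<open>\<sigma> / 2\<close>. The second argument of \<^const>\<open>normal_density\<close> is the standard deviation.\<close>

definition (in prob_space) circular_normal :: "('a \<Rightarrow> complex) \<Rightarrow> real \<Rightarrow> bool" where
  "circular_normal Z \<sigma> \<longleftrightarrow>
     distributed M lborel (\<lambda>\<omega>. Re (Z \<omega>)) (normal_density 0 (sqrt (\<sigma> / 2))) \<and>
     distributed M lborel (\<lambda>\<omega>. Im (Z \<omega>)) (normal_density 0 (sqrt (\<sigma> / 2))) \<and>
     indep_var borel (\<lambda>\<omega>. Re (Z \<omega>)) borel (\<lambda>\<omega>. Im (Z \<omega>))"

text \<open>\<^const>\<open>prob_space.indep_var\<close> requires both random variables to take values in the same type;
  this is the same notion without that restriction.\<close>

definition (in prob_space) indep_var_het ::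
    "'b measure \<Rightarrow> ('a \<Rightarrow> 'b) \<Rightarrow> 'c measure \<Rightarrow> ('a \<Rightarrow> 'c) \<Rightarrow> bool" where
  "indep_var_het S X T Y \<longleftrightarrow>
     random_variable S X \<and> random_variable T Y \<and>
     indep_set {X -` A \<inter> space M | A. A \<in> sets S} {Y -` B \<inter> space M | B. B \<in> sets T}"

definition signal ::
    "nat \<Rightarrow> nat \<Rightarrow> (nat \<Rightarrow> complex vec) \<Rightarrow> (nat \<Rightarrow> 'w \<Rightarrow> complex) \<Rightarrow> 'w \<Rightarrow> complex vec" where
  "signal L r v a \<omega> = Matrix.vec L (\<lambda>l. \<Sum>i<r. a i \<omega> * v i $ l)"

definition observation ::
    "nat \<Rightarrow> nat \<Rightarrow> (nat \<Rightarrow> complex vec) \<Rightarrow> (nat \<Rightarrow> 'w \<Rightarrow> complex) \<Rightarrow> ('w \<Rightarrow> nat) \<Rightarrow> 'w \<Rightarrow> complex vec" where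
  "observation L r v a s \<omega> = cyclic_shift L (s \<omega>) (signal L r v a \<omega>)"

text \<open>The law of the shift \<open>s\<close> is unrestricted. Independence of \<open>s\<close> and the random vector
  \<open>signal L r v a\<close> is expressed through the tuple of coordinates of the latter, since
  \<^typ>\<open>complex vec\<close> carries no measurable structure.\<close>

locale mra_model = prob_space M
  for M :: "'w measure" +
  fixes L r :: nat
    and v :: "nat \<Rightarrow> complex vec"
    and lam :: "nat \<Rightarrow> real"
    and a :: "nat \<Rightarrow> 'w \<Rightarrow> complex"
    and s :: "'w \<Rightarrow> nat"
  assumes orthonormal: "orthonormal_vecs L r v"
    and lam_pos: "\<And>i. i < r \<Longrightarrow> 0 < lam i"
    and coeff_indep: "indep_vars (\<lambda>_. borel) a {..<r}"
    and coeff_normal: "\<And>i. i < r \<Longrightarrow> circular_normal (a i) (lam i)"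
    and shift_indep:
      "indep_var_het (PiM {..<L} (\<lambda>_. borel)) (\<lambda>\<omega>. \<lambda>l\<in>{..<L}. signal L r v a \<omega> $ l)
                     (count_space {..<L}) s"

definition dft :: "nat \<Rightarrow> ('w \<Rightarrow> complex vec) \<Rightarrow> 'w \<Rightarrow> complex vec" where
  "dft L z \<omega> = dft_mat L *\<^sub>v z \<omega>"

definition fourier_cov :: "'w measure \<Rightarrow> nat \<Rightarrow> ('w \<Rightarrow> complex vec) \<Rightarrow> complex mat" where
  "fourier_cov M L x =
     Matrix.mat L L (\<lambda>(i, j). integral\<^sup>L M (\<lambda>\<omega>. dft L x \<omega> $ i * cnj (dft L x \<omega> $ j)))"

definition power_spectrum :: "'w measure \<Rightarrow> nat \<Rightarrow> ('w \<Rightarrow> complex vec) \<Rightarrow> nat \<Rightarrow> complex" where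
  "power_spectrum M L y k = integral\<^sup>L M (\<lambda>\<omega>. dft L y \<omega> $ k * cnj (dft L y \<omega> $ k))"

definition trispectrum ::
    "'w measure \<Rightarrow> nat \<Rightarrow> ('w \<Rightarrow> complex vec) \<Rightarrow> nat \<Rightarrow> nat \<Rightarrow> nat \<Rightarrow> complex" where
  "trispectrum M L y k1 k2 k3 = integral\<^sup>L M (\<lambda>\<omega>.
     dft L y \<omega> $ k1 * cnj (dft L y \<omega> $ k2) * dft L y \<omega> $ k3 *
     cnj (dft L y \<omega> $ zmod_index L (int k1 - int k2 + int k3)))"

definition P_map :: "complex mat \<Rightarrow> nat \<Rightarrow> complex" where
  "P_map X k1 = X $$ (k1, k1)"

definition T_map :: "nat \<Rightarrow> complex mat \<Rightarrow> nat \<Rightarrow> nat \<Rightarrow> nat \<Rightarrow> complex" where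
  "T_map L X k1 k2 k3 =
     X $$ (k1, k2) * cnj (X $$ (zmod_index L (int k3 - int k2 + int k1), k3)) +
     X $$ (k1, zmod_index L (int k3 - int k2 + int k1)) * cnj (X $$ (k2, k3))"

definition ambiguity_set :: "nat \<Rightarrow> complex mat \<Rightarrow> complex mat set" where
  "ambiguity_set L S =
     {mat_diag L (\<lambda>k. fourier_vec L l $ k) * S * mat_diag L (\<lambda>k. cnj (fourier_vec L l $ k)) | l. l < L}"

definition hermitian_mat :: "complex mat \<Rightarrow> bool" where
  "hermitian_mat X \<longleftrightarrow> mat_adjoint X = X"

text \<open>The order on \<^typ>\<open>complex\<close> is the partial one: \<open>0 < z\<close> says that \<open>z\<close> is real and positive.\<close>

definition positive_definite_mat :: "nat \<Rightarrow> complex mat \<Rightarrow> bool" where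
  "positive_definite_mat L X \<longleftrightarrow>
     X \<in> carrier_mat L L \<and> (\<forall>u \<in> carrier_vec L. u \<noteq> 0\<^sub>v L \<longrightarrow> 0 < (X *\<^sub>v u) \<bullet>c u)"

end

theory Submission
  imports Defs
begin

text \<open>A random cyclic shift multiplies the Fourier coefficients of the signal by characters that cancel
  in both spectra, so these are moments of the signal itself; by Wick's formula they are
  \<open>P(\<Sigma>)\<close> and \<open>T(\<Sigma>)\<close>, where \<open>\<Sigma>\<close> is the Fourier covariance. Both maps depend on each
  cyclic diagonal of their argument only up to a unimodular factor. Multiplying the diagonals
  \<open>j - i \<equiv> 1\<close> and \<open>j - i \<equiv> -1\<close> (distinct because \<open>L \<ge> 3\<close>) by \<open>cis \<theta>\<close> and
  \<open>cis (- \<theta>)\<close> keeps the matrix Hermitian and both maps unchanged. If \<open>r = L\<close>, the smallest eigenvalue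
  of \<open>\<Sigma>\<close> is positive, so the new matrix stays positive definite for small \<open>\<theta>\<close>; it leaves the
  ambiguity set because \<open>cis \<theta>\<close> is not an \<open>L\<close>-th root of unity for \<open>0 < \<theta> < 2 * pi / L\<close>.\<close>

subsection \<open>Moments of independent circular normal variables\<close>

lemma (in prob_space) centred_normal_power_integrable:
  assumes "distributed M lborel X (normal_density 0 \<tau>)" "0 < \<tau>"
  shows "integrable M (\<lambda>\<omega>. X \<omega> ^ p)"
  using distributed_integrable[OF assms(1), of "\<lambda>x. x ^ p"] integrable_normal_moment[OF assms(2), of 0 p]
  by simp

lemma (in prob_space) centred_normal_power_expectation:
  assumes "distributed M lborel X (normal_density 0 \<tau>)" "0 < \<tau>"
  shows "expectation (\<lambda>\<omega>. X \<omega> ^ (2 * k)) = fact (2 * k) / ((2 / \<tau>\<^sup>2) ^ k * fact k)"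
    and "expectation (\<lambda>\<omega>. X \<omega> ^ (2 * k + 1)) = 0"
  using distributed_integral[OF assms(1), of "\<lambda>x. x ^ (2 * k)"]
    integral_normal_moment_even[OF assms(2), of 0 k]
    distributed_integral[OF assms(1), of "\<lambda>x. x ^ (2 * k + 1)"]
    integral_normal_moment_odd[OF assms(2), of 0 k]
  by simp_all

text \<open>The real and imaginary parts of a circular normal variable of variance
  \<open>\<sigma>\<close> have variance \<open>\<sigma> / 2\<close> each. Order four suffices
  because the trispectrum has degree four.\<close>

lemma (in prob_space) centred_normal_moments_upto_4:
  assumes "distributed M lborel X (normal_density 0 (sqrt (\<sigma> / 2)))" "0 < \<sigma>"
  shows "expectation (\<lambda>\<omega>. X \<omega> ^ 0) = 1"
    and "expectation (\<lambda>\<omega>. X \<omega> ^ 1) = 0"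
    and "expectation (\<lambda>\<omega>. X \<omega> ^ 2) = \<sigma> / 2"
    and "expectation (\<lambda>\<omega>. X \<omega> ^ 3) = 0"
    and "expectation (\<lambda>\<omega>. X \<omega> ^ 4) = 3 * \<sigma>\<^sup>2 / 4"
proof -
  have s: "0 < sqrt (\<sigma> / 2)" using assms(2) by simp
  note even = centred_normal_power_expectation(1)[OF assms(1) s]
  note odd = centred_normal_power_expectation(2)[OF assms(1) s]
  show "expectation (\<lambda>\<omega>. X \<omega> ^ 0) = 1"
    "expectation (\<lambda>\<omega>. X \<omega> ^ 1) = 0"
    "expectation (\<lambda>\<omega>. X \<omega> ^ 2) = \<sigma> / 2"
    "expectation (\<lambda>\<omega>. X \<omega> ^ 3) = 0"
    "expectation (\<lambda>\<omega>. X \<omega> ^ 4) = 3 * \<sigma>\<^sup>2 / 4"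
    using even[of 0] even[of 1] even[of 2] odd[of 0] odd[of 1] assms(2)
    by (simp_all add: fact_numeral power_divide prob_space)
qed

text \<open>Independence of real and imaginary part factors the mixed moment. Using
  \<open>has_bochner_integral\<close> carries integrability along with the value, so later
  expansions are pure linearity.\<close>

lemma (in prob_space) circular_normal_monomial:
  assumes Z: "circular_normal Z \<sigma>" and \<sigma>: "0 < \<sigma>"
  shows "has_bochner_integral M (\<lambda>\<omega>. complex_of_real (Re (Z \<omega>) ^ p * Im (Z \<omega>) ^ q))
    (complex_of_real (expectation (\<lambda>\<omega>. Re (Z \<omega>) ^ p) * expectation (\<lambda>\<omega>. Im (Z \<omega>) ^ q)))"
proof -
  have X: "distributed M lborel (\<lambda>\<omega>. Re (Z \<omega>)) (normal_density 0 (sqrt (\<sigma> / 2)))"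
    and Y: "distributed M lborel (\<lambda>\<omega>. Im (Z \<omega>)) (normal_density 0 (sqrt (\<sigma> / 2)))"
    and ind: "indep_var borel (\<lambda>\<omega>. Re (Z \<omega>)) borel (\<lambda>\<omega>. Im (Z \<omega>))"
    using Z unfolding circular_normal_def by auto
  have s: "0 < sqrt (\<sigma> / 2)" using \<sigma> by simp
  have ind': "indep_var borel (\<lambda>\<omega>. Re (Z \<omega>) ^ p) borel (\<lambda>\<omega>. Im (Z \<omega>) ^ q)"
    using indep_var_compose[OF ind, of "\<lambda>x. x ^ p" borel "\<lambda>x. x ^ q" borel] by (simp add: comp_def)
  have iX: "integrable M (\<lambda>\<omega>. Re (Z \<omega>) ^ p)" and iY: "integrable M (\<lambda>\<omega>. Im (Z \<omega>) ^ q)"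
    using centred_normal_power_integrable[OF X s] centred_normal_power_integrable[OF Y s] by auto
  show ?thesis
    unfolding indep_var_lebesgue_integral[OF ind' iX iY, symmetric]
    by (rule has_bochner_integral_of_real, rule has_bochner_integral_integrable,
        rule indep_var_integrable[OF ind' iX iY])
qed

text \<open>The vanishing for \<open>m \<noteq> n\<close> reflects the invariance of the law under
  rotations; here it is computed from the real moments. The bound 2 covers the trispectrum, with its
  two plain and two conjugated factors.\<close>

lemma (in prob_space) circular_normal_moment:
  assumes Z: "circular_normal Z \<sigma>" and \<sigma>: "0 < \<sigma>" and m: "m \<le> 2" and n: "n \<le> 2"
  shows "has_bochner_integral M (\<lambda>\<omega>. Z \<omega> ^ m * cnj (Z \<omega>) ^ n)
    (if m = n then fact m * of_real \<sigma> ^ m else 0)"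
proof -
  have X: "distributed M lborel (\<lambda>\<omega>. Re (Z \<omega>)) (normal_density 0 (sqrt (\<sigma> / 2)))"
    and Y: "distributed M lborel (\<lambda>\<omega>. Im (Z \<omega>)) (normal_density 0 (sqrt (\<sigma> / 2)))"
    using Z unfolding circular_normal_def by auto
  have s: "0 < sqrt (\<sigma> / 2)" using \<sigma> by simp
  define R where "R p = expectation (\<lambda>\<omega>. Re (Z \<omega>) ^ p)" for p
  define I where "I p = expectation (\<lambda>\<omega>. Im (Z \<omega>) ^ p)" for p
  note mono = circular_normal_monomial[OF Z \<sigma>, folded R_def I_def]
  note R = centred_normal_moments_upto_4[OF X \<sigma>, folded R_def]
  note I = centred_normal_moments_upto_4[OF Y \<sigma>, folded I_def]
  \<comment> \<open>The binomial theorem for \<open>Z = Re Z + \<i> * Im Z\<close> and its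
    conjugate, integrated term by term.\<close>
  have expand: "has_bochner_integral M (\<lambda>\<omega>. Z \<omega> ^ m * cnj (Z \<omega>) ^ n)
      (\<Sum>k\<le>m. \<Sum>j\<le>n. of_nat (m choose k) * of_nat (n choose j) * \<i> ^ (m - k) * (- \<i>) ^ (n - j) *
        complex_of_real (R (k + j) * I (m - k + (n - j))))"
  proof -
    have "Z \<omega> ^ m * cnj (Z \<omega>) ^ n = (\<Sum>k\<le>m. \<Sum>j\<le>n.
        of_nat (m choose k) * of_nat (n choose j) * \<i> ^ (m - k) * (- \<i>) ^ (n - j) *
        complex_of_real (Re (Z \<omega>) ^ (k + j) * Im (Z \<omega>) ^ (m - k + (n - j))))" for \<omega>
    proof -
      have "Z \<omega> = of_real (Re (Z \<omega>)) + \<i> * of_real (Im (Z \<omega>))"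
        by (simp add: complex_eq)
      moreover have "cnj (Z \<omega>) = of_real (Re (Z \<omega>)) + (- \<i>) * of_real (Im (Z \<omega>))"
        by (simp add: complex_eq_iff)
      ultimately have "Z \<omega> ^ m * cnj (Z \<omega>) ^ n =
          (of_real (Re (Z \<omega>)) + \<i> * of_real (Im (Z \<omega>))) ^ m *
          (of_real (Re (Z \<omega>)) + (- \<i>) * of_real (Im (Z \<omega>))) ^ n"
        by presburger
      then show ?thesis
        unfolding binomial_ring sum_product
        by (simp only: of_real_mult of_real_power power_mult_distrib power_add mult_ac)
    qed
    then show ?thesis
      by (simp only:) (intro has_bochner_integral_sum has_bochner_integral_mult_right mono)
  qed
  have eq: "(\<Sum>k\<le>m. \<Sum>j\<le>n. of_nat (m choose k) * of_nat (n choose j) * \<i> ^ (m - k) * (- \<i>) ^ (n - j) *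
        complex_of_real (R (k + j) * I (m - k + (n - j)))) = (if m = n then fact m * of_real \<sigma> ^ m else 0)"
  proof -
    \<comment> \<open>Nine cases remain. The moments are restated with \<open>Suc\<close> to match
      the normal form that \<open>eval_nat_numeral\<close> produces.\<close>
    have cases: "m = 0 \<or> m = 1 \<or> m = 2" "n = 0 \<or> n = 1 \<or> n = 2" using m n by auto
    have RI: "R 0 = 1" "R (Suc 0) = 0" "R (Suc (Suc 0)) = \<sigma> / 2" "R (Suc (Suc (Suc 0))) = 0"
        "R (Suc (Suc (Suc (Suc 0)))) = 3 * \<sigma>\<^sup>2 / 4"
        "I 0 = 1" "I (Suc 0) = 0" "I (Suc (Suc 0)) = \<sigma> / 2" "I (Suc (Suc (Suc 0))) = 0"
        "I (Suc (Suc (Suc (Suc 0)))) = 3 * \<sigma>\<^sup>2 / 4"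
      using R I by (simp_all add: eval_nat_numeral)
    show ?thesis using cases
      by (elim disjE) (simp_all add: eval_nat_numeral RI add_divide_distrib[symmetric] flip: of_real_add)
  qed
  show ?thesis using expand unfolding eq .
qed

section \<open>Mixed moments of an independent family and Wick's formula\<close>

text \<open>Monomials are encoded by exponents at every index, so that each factor depends on a
  single variable of the family and the expectation factors even when indices repeat.\<close>

lemma (in prob_space) indep_circular_normal_moment:
  fixes I :: "'i set"
  assumes fin: "finite I"
    and ind: "indep_vars (\<lambda>_. borel) a I"
    and normal: "\<And>i. i \<in> I \<Longrightarrow> circular_normal (a i) (lam i)"
    and pos: "\<And>i. i \<in> I \<Longrightarrow> 0 < lam i"
    and m: "\<And>i. i \<in> I \<Longrightarrow> m i \<le> 2" and n: "\<And>i. i \<in> I \<Longrightarrow> n i \<le> 2"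
  shows "has_bochner_integral M (\<lambda>\<omega>. \<Prod>i\<in>I. a i \<omega> ^ m i * cnj (a i \<omega>) ^ n i)
    (\<Prod>i\<in>I. if m i = n i then fact (m i) * of_real (lam i) ^ m i else 0)"
proof -
  have hb: "has_bochner_integral M (\<lambda>\<omega>. a i \<omega> ^ m i * cnj (a i \<omega>) ^ n i)
      (if m i = n i then fact (m i) * of_real (lam i) ^ m i else 0)" if "i \<in> I" for i
    using that by (intro circular_normal_moment normal pos m n)
  have ind': "indep_vars (\<lambda>_. borel) (\<lambda>i \<omega>. a i \<omega> ^ m i * cnj (a i \<omega>) ^ n i) I"
    by (rule indep_vars_compose2[OF ind, of "\<lambda>i z. z ^ m i * cnj z ^ n i"])
      (intro borel_measurable_continuous_onI continuous_intros)
  have int: "integrable M (\<lambda>\<omega>. a i \<omega> ^ m i * cnj (a i \<omega>) ^ n i)" if "i \<in> I" for i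
    using hb[OF that] by (rule integrable.intros)
  have "integral\<^sup>L M (\<lambda>\<omega>. \<Prod>i\<in>I. a i \<omega> ^ m i * cnj (a i \<omega>) ^ n i) =
      (\<Prod>i\<in>I. if m i = n i then fact (m i) * of_real (lam i) ^ m i else 0)"
    using indep_vars_lebesgue_integral[OF fin ind' int]
    by (simp add: has_bochner_integral_integral_eq[OF hb])
  moreover have "integrable M (\<lambda>\<omega>. \<Prod>i\<in>I. a i \<omega> ^ m i * cnj (a i \<omega>) ^ n i)"
    by (rule indep_vars_integrable[OF fin ind' int])
  ultimately show ?thesis by (simp only: has_bochner_integral_iff)
qed

text \<open>Indicator exponents write a single variable as a product over the whole family, the form
  required by \<open>indep_circular_normal_moment\<close>.\<close>

lemma prod_power_of_bool:
  fixes f :: "'i \<Rightarrow> 'c::comm_monoid_mult"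
  assumes "finite I" "i \<in> I"
  shows "(\<Prod>p\<in>I. f p ^ of_bool (p = i)) = f i"
proof -
  have "(\<Prod>p\<in>I. f p ^ of_bool (p = i)) = (\<Prod>p\<in>I. if p = i then f p else 1)"
    by (intro prod.cong) auto
  then show ?thesis using assms by simp
qed

lemma (in prob_space) indep_circular_normal_second_moment:
  fixes I :: "'i set"
  assumes fin: "finite I"
    and ind: "indep_vars (\<lambda>_. borel) a I"
    and normal: "\<And>i. i \<in> I \<Longrightarrow> circular_normal (a i) (lam i)"
    and pos: "\<And>i. i \<in> I \<Longrightarrow> 0 < lam i"
    and ij: "i \<in> I" "j \<in> I"
  shows "has_bochner_integral M (\<lambda>\<omega>. a i \<omega> * cnj (a j \<omega>)) (of_bool (i = j) * of_real (lam i))"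
proof -
  have "has_bochner_integral M
      (\<lambda>\<omega>. \<Prod>p\<in>I. a p \<omega> ^ of_bool (p = i) * cnj (a p \<omega>) ^ of_bool (p = j))
      (\<Prod>p\<in>I. if of_bool (p = i) = (of_bool (p = j) :: nat)
        then fact (of_bool (p = i)) * of_real (lam p) ^ of_bool (p = i) else 0)"
    by (rule indep_circular_normal_moment[OF fin ind normal pos]) auto
  moreover have "(\<Prod>p\<in>I. a p \<omega> ^ of_bool (p = i) * cnj (a p \<omega>) ^ of_bool (p = j)) =
      a i \<omega> * cnj (a j \<omega>)" for \<omega>
    by (simp add: prod.distrib prod_power_of_bool[OF fin] ij)
  moreover have "(\<Prod>p\<in>I. if of_bool (p = i) = (of_bool (p = j) :: nat)
      then fact (of_bool (p = i)) * of_real (lam p) ^ of_bool (p = i) else 0) =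
      (of_bool (i = j) * of_real (lam i) :: complex)"
  proof (cases "i = j")
    case True
    have "(fact (of_bool (p = i)) :: complex) = 1" for p by simp
    then show ?thesis using True by (simp add: prod_power_of_bool[OF fin] ij)
  next
    case False
    \<comment> \<open>For \<open>i \<noteq> j\<close> the factor at \<open>p = i\<close> has
      exponents 1 and 0, hence is zero.\<close>
    then show ?thesis using ij fin by (auto intro!: prod_zero bexI[of _ i])
  qed
  ultimately show ?thesis by simp
qed

text \<open>The moment survives only if \<open>{i, k}\<close> and \<open>{j, l}\<close> agree as
  multisets. When \<open>i = k\<close>, the two indicators both hold and their sum 2 is the
  factorial in the moment of order (2, 2).\<close>

lemma (in prob_space) indep_circular_normal_fourth_moment:
  fixes I :: "'i set"
  assumes fin: "finite I"
    and ind: "indep_vars (\<lambda>_. borel) a I"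
    and normal: "\<And>i. i \<in> I \<Longrightarrow> circular_normal (a i) (lam i)"
    and pos: "\<And>i. i \<in> I \<Longrightarrow> 0 < lam i"
    and ijkl: "i \<in> I" "j \<in> I" "k \<in> I" "l \<in> I"
  shows "has_bochner_integral M (\<lambda>\<omega>. a i \<omega> * cnj (a j \<omega>) * a k \<omega> * cnj (a l \<omega>))
    ((of_bool (i = j \<and> k = l) + of_bool (i = l \<and> k = j)) * (of_real (lam i) * of_real (lam k)))"
proof -
  \<comment> \<open>\<open>m\<close> and \<open>n\<close> count how often an index occurs among the
    plain and among the conjugated factors.\<close>
  define m n :: "'i \<Rightarrow> nat"
    where "m p = of_bool (p = i) + of_bool (p = k)" and "n p = of_bool (p = j) + of_bool (p = l)" for p
  have "has_bochner_integral M (\<lambda>\<omega>. \<Prod>p\<in>I. a p \<omega> ^ m p * cnj (a p \<omega>) ^ n p)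
      (\<Prod>p\<in>I. if m p = n p then fact (m p) * of_real (lam p) ^ m p else 0)"
    by (rule indep_circular_normal_moment[OF fin ind normal pos]) (auto simp: m_def n_def)
  moreover have "(\<Prod>p\<in>I. a p \<omega> ^ m p * cnj (a p \<omega>) ^ n p) =
      a i \<omega> * cnj (a j \<omega>) * a k \<omega> * cnj (a l \<omega>)" for \<omega>
    by (simp add: m_def n_def power_add prod.distrib prod_power_of_bool[OF fin] ijkl)
  moreover have "(\<Prod>p\<in>I. if m p = n p then fact (m p) * of_real (lam p) ^ m p else 0) =
      ((of_bool (i = j \<and> k = l) + of_bool (i = l \<and> k = j)) *
        (of_real (lam i) * of_real (lam k)) :: complex)"
  proof (cases "(i = j \<and> k = l) \<or> (i = l \<and> k = j)")
    case True
    then have mn: "m p = n p" for p by (auto simp: m_def n_def)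
    \<comment> \<open>Only a coincidence \<open>i = k\<close> gives an exponent 2, and so a
      factorial other than 1.\<close>
    have "(\<Prod>p\<in>I. fact (m p) :: complex) = (\<Prod>p\<in>I. if p = i then (if i = k then 2 else 1) else 1)"
      by (intro prod.cong) (auto simp: m_def)
    also have "\<dots> = (if i = k then 2 else 1)" using fin ijkl by simp
    also have "\<dots> = of_bool (i = j \<and> k = l) + of_bool (i = l \<and> k = j)" using True by auto
    finally have "(\<Prod>p\<in>I. fact (m p) :: complex) = of_bool (i = j \<and> k = l) + of_bool (i = l \<and> k = j)" .
    moreover have "(\<Prod>p\<in>I. complex_of_real (lam p) ^ m p) = of_real (lam i) * of_real (lam k)"
      by (simp add: m_def power_add prod.distrib prod_power_of_bool[OF fin] ijkl)
    ultimately show ?thesis by (simp add: mn[symmetric] prod.distrib)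
  next
    case False
    then have "\<exists>p\<in>{i, j, k, l}. m p \<noteq> n p"
      by (auto simp: m_def n_def of_bool_def split: if_splits)
    then obtain p where "p \<in> I" "m p \<noteq> n p" using ijkl by blast
    then have "\<exists>p\<in>I. (if m p = n p then fact (m p) * of_real (lam p) ^ m p else 0) = (0 :: complex)"
      by (intro bexI[of _ p]) simp_all
    then have "(\<Prod>p\<in>I. if m p = n p then fact (m p) * of_real (lam p) ^ m p else 0) = (0 :: complex)"
      by (rule prod_zero[OF fin])
    moreover have "of_bool (i = j \<and> k = l) + of_bool (i = l \<and> k = j) = (0 :: complex)"
      using False by (simp only: de_Morgan_disj of_bool_eq simp_thms add_0_left)
    ultimately show ?thesis by (simp only: mult_zero_left)
  qed
  ultimately show ?thesis by simp
qed

text \<open>For linear forms in the same circular normal family, only pairings of a plain factor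
  with a conjugated one contribute: one pairing in degree two, two in degree four.\<close>

lemma (in prob_space) circular_normal_Wick:
  fixes I :: "'i set" and b c d e :: "'i \<Rightarrow> complex"
  assumes fin: "finite I"
    and ind: "indep_vars (\<lambda>_. borel) a I"
    and normal: "\<And>i. i \<in> I \<Longrightarrow> circular_normal (a i) (lam i)"
    and pos: "\<And>i. i \<in> I \<Longrightarrow> 0 < lam i"
  defines "Z \<equiv> \<lambda>u \<omega>. \<Sum>i\<in>I. a i \<omega> * u i"
    and "C \<equiv> \<lambda>u w. \<Sum>i\<in>I. of_real (lam i) * u i * cnj (w i)"
  shows "expectation (\<lambda>\<omega>. Z b \<omega> * cnj (Z c \<omega>)) = C b c"
    and "expectation (\<lambda>\<omega>. Z b \<omega> * cnj (Z c \<omega>) * Z d \<omega> * cnj (Z e \<omega>)) = C b c * C d e + C b e * C d c"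
proof -
  have "Z b \<omega> * cnj (Z c \<omega>) = (\<Sum>i\<in>I. \<Sum>j\<in>I. b i * cnj (c j) * (a i \<omega> * cnj (a j \<omega>)))" for \<omega>
    by (simp add: Z_def sum_product mult_ac)
  moreover have "has_bochner_integral M (\<lambda>\<omega>. \<Sum>i\<in>I. \<Sum>j\<in>I. b i * cnj (c j) * (a i \<omega> * cnj (a j \<omega>)))
      (\<Sum>i\<in>I. \<Sum>j\<in>I. b i * cnj (c j) * (of_bool (i = j) * of_real (lam i)))"
    by (intro has_bochner_integral_sum has_bochner_integral_mult_right
        indep_circular_normal_second_moment[OF fin ind normal pos])
  moreover have "(\<Sum>i\<in>I. \<Sum>j\<in>I. b i * cnj (c j) * (of_bool (i = j) * of_real (lam i))) = C b c"
    unfolding C_def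
  proof (rule sum.cong[OF refl])
    fix i assume "i \<in> I"
    have "(\<Sum>j\<in>I. b i * cnj (c j) * (of_bool (i = j) * of_real (lam i))) =
      (\<Sum>j\<in>I. if i = j then b i * cnj (c j) * of_real (lam i) else 0)"
      by (intro sum.cong) auto
    then show "(\<Sum>j\<in>I. b i * cnj (c j) * (of_bool (i = j) * of_real (lam i))) =
        of_real (lam i) * b i * cnj (c i)"
      using fin \<open>i \<in> I\<close> by (simp add: mult_ac)
  qed
  ultimately show "expectation (\<lambda>\<omega>. Z b \<omega> * cnj (Z c \<omega>)) = C b c"
    by (simp add: has_bochner_integral_iff)
next
  have "Z b \<omega> * cnj (Z c \<omega>) * Z d \<omega> * cnj (Z e \<omega>) = (\<Sum>i\<in>I. \<Sum>k\<in>I. \<Sum>j\<in>I. \<Sum>l\<in>I.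
      b i * cnj (c j) * d k * cnj (e l) * (a i \<omega> * cnj (a j \<omega>) * a k \<omega> * cnj (a l \<omega>)))" for \<omega>
  proof -
    have "Z b \<omega> * cnj (Z c \<omega>) * Z d \<omega> * cnj (Z e \<omega>) =
        (Z b \<omega> * cnj (Z c \<omega>)) * (Z d \<omega> * cnj (Z e \<omega>))"
      by simp
    also have "\<dots> = (\<Sum>i\<in>I. \<Sum>k\<in>I. \<Sum>j\<in>I. \<Sum>l\<in>I. (a i \<omega> * b i * cnj (a j \<omega> * c j)) *
        (a k \<omega> * d k * cnj (a l \<omega> * e l)))"
      by (simp only: Z_def cnj_sum sum_product)
    finally show ?thesis by (simp only: complex_cnj_mult mult_ac)
  qed
  moreover have "has_bochner_integral M (\<lambda>\<omega>. \<Sum>i\<in>I. \<Sum>k\<in>I. \<Sum>j\<in>I. \<Sum>l\<in>I.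
        b i * cnj (c j) * d k * cnj (e l) * (a i \<omega> * cnj (a j \<omega>) * a k \<omega> * cnj (a l \<omega>)))
      (\<Sum>i\<in>I. \<Sum>k\<in>I. \<Sum>j\<in>I. \<Sum>l\<in>I. b i * cnj (c j) * d k * cnj (e l) *
        ((of_bool (i = j \<and> k = l) + of_bool (i = l \<and> k = j)) * (of_real (lam i) * of_real (lam k))))"
    by (intro has_bochner_integral_sum has_bochner_integral_mult_right
        indep_circular_normal_fourth_moment[OF fin ind normal pos])
  moreover have "(\<Sum>i\<in>I. \<Sum>k\<in>I. \<Sum>j\<in>I. \<Sum>l\<in>I. b i * cnj (c j) * d k * cnj (e l) *
        ((of_bool (i = j \<and> k = l) + of_bool (i = l \<and> k = j)) * (of_real (lam i) * of_real (lam k)))) =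
      C b c * C d e + C b e * C d c"
  proof -
    \<comment> \<open>With the plain indices \<open>i\<close>, \<open>k\<close> fixed, the two
      indicators collapse the sums over \<open>j\<close> and \<open>l\<close> to
      \<open>(j, l) = (i, k)\<close> and \<open>(j, l) = (k, i)\<close>.\<close>
    have inner: "(\<Sum>j\<in>I. \<Sum>l\<in>I. b i * cnj (c j) * d k * cnj (e l) *
        ((of_bool (i = j \<and> k = l) + of_bool (i = l \<and> k = j)) * (of_real (lam i) * of_real (lam k)))) =
        of_real (lam i) * b i * cnj (c i) * (of_real (lam k) * d k * cnj (e k)) +
        of_real (lam i) * b i * cnj (e i) * (of_real (lam k) * d k * cnj (c k))"
      if "i \<in> I" "k \<in> I" for i k
    proof -
      have "(\<Sum>j\<in>I. \<Sum>l\<in>I. b i * cnj (c j) * d k * cnj (e l) *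
          ((of_bool (i = j \<and> k = l) + of_bool (i = l \<and> k = j)) * (of_real (lam i) * of_real (lam k)))) =
          (\<Sum>j\<in>I. \<Sum>l\<in>I. (if j = i then if l = k then b i * cnj (c j) * d k * cnj (e l) *
            (of_real (lam i) * of_real (lam k)) else 0 else 0) +
          (if j = k then if l = i then b i * cnj (c j) * d k * cnj (e l) *
            (of_real (lam i) * of_real (lam k)) else 0 else 0))"
        by (intro sum.cong refl) (auto simp: of_bool_def)
      also have "\<dots> = (\<Sum>j\<in>I. (if j = i then \<Sum>l\<in>I. if l = k then b i * cnj (c j) * d k * cnj (e l) *
            (of_real (lam i) * of_real (lam k)) else 0 else 0) +
          (if j = k then \<Sum>l\<in>I. if l = i then b i * cnj (c j) * d k * cnj (e l) *
            (of_real (lam i) * of_real (lam k)) else 0 else 0))"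
        unfolding sum.distrib by (intro arg_cong2[of _ _ _ _ "(+)"] sum.cong refl) auto
      also have "\<dots> = of_real (lam i) * b i * cnj (c i) * (of_real (lam k) * d k * cnj (e k)) +
          of_real (lam i) * b i * cnj (e i) * (of_real (lam k) * d k * cnj (c k))"
        unfolding sum.distrib using fin that by (simp add: mult_ac)
      finally show ?thesis .
    qed
    show ?thesis
      unfolding C_def sum_product sum.distrib[symmetric] by (intro sum.cong refl inner)
  qed
  ultimately show "expectation (\<lambda>\<omega>. Z b \<omega> * cnj (Z c \<omega>) * Z d \<omega> * cnj (Z e \<omega>)) =
      C b c * C d e + C b e * C d c"
    by (simp only: has_bochner_integral_iff)
qed

subsection \<open>The discrete Fourier transform\<close>

text \<open>The character \<open>n \<mapsto> exp (- 2 pi i n / L)\<close> of the integers modulo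
  \<open>L\<close>; an integer argument allows differences of indices.\<close>

definition fourier_char :: "nat \<Rightarrow> int \<Rightarrow> complex" where
  "fourier_char L n = cis (- (2 * pi * (of_int n / of_nat L)))"

lemma norm_fourier_char [simp]: "cmod (fourier_char L n) = 1"
  by (simp add: fourier_char_def)

lemma fourier_char_0 [simp]: "fourier_char L 0 = 1"
  by (simp add: fourier_char_def)

lemma fourier_char_add: "fourier_char L (m + n) = fourier_char L m * fourier_char L n"
  by (simp add: fourier_char_def cis_mult add_divide_distrib algebra_simps)

lemma cnj_fourier_char: "cnj (fourier_char L n) = fourier_char L (- n)"
  by (simp add: fourier_char_def cis_cnj)

lemma fourier_char_mult_of_nat: "fourier_char L (n * int k) = fourier_char L n ^ k"
  unfolding fourier_char_def Complex.DeMoivre by (rule arg_cong[of _ _ cis]) simp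

lemma fourier_char_period [simp]: "0 < L \<Longrightarrow> fourier_char L (int L * n) = 1"
  using cis_multiple_2pi[of "- of_int n"] by (simp add: fourier_char_def)

lemma fourier_char_cong:
  assumes "0 < L" "m mod int L = n mod int L"
  shows "fourier_char L m = fourier_char L n"
proof -
  obtain q where "m = n + int L * q"
    using assms(2) by (metis mod_eqE)
  then show ?thesis using assms(1) by (simp add: fourier_char_add)
qed

lemma fourier_char_eq_1_imp_dvd:
  assumes "0 < L" "fourier_char L n = 1"
  shows "int L dvd n"
proof -
  have "cos (2 * pi * (of_int n / of_nat L)) = 1"
    using assms(2) by (simp add: fourier_char_def complex_eq_iff)
  then obtain q :: int where "2 * pi * (of_int n / of_nat L) = of_int q * 2 * pi"
    unfolding cos_one_2pi_int by blast
  then have "of_int n = (of_int (q * int L) :: real)"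
    using assms(1) by (simp add: field_simps)
  then have "n = q * int L" by (simp only: of_int_eq_iff)
  then show ?thesis by simp
qed

text \<open>Orthogonality of characters: a geometric sum whose ratio is an \<open>L\<close>-th root
  of unity, different from 1 unless \<open>L\<close> divides \<open>n\<close>.\<close>

lemma fourier_char_sum:
  assumes "0 < L"
  shows "(\<Sum>j<L. fourier_char L (n * int j)) = (if int L dvd n then of_nat L else 0)"
proof (cases "int L dvd n")
  case True
  have "fourier_char L (n * int j) = 1" for j
    using True assms fourier_char_period[of L] by (metis dvd_def mult.assoc)
  then show ?thesis using True by simp
next
  case False
  then have ne: "fourier_char L n \<noteq> 1" using fourier_char_eq_1_imp_dvd[OF assms] by blast
  have "fourier_char L n ^ L = 1"
    using fourier_char_period[OF assms, of n] by (simp add: fourier_char_mult_of_nat[symmetric] mult.commute)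
  then show ?thesis using False ne by (simp add: fourier_char_mult_of_nat geometric_sum)
qed

section \<open>Unitarity of the DFT matrix and completeness of orthonormal systems\<close>

lemma fourier_vec_nth: "k < L \<Longrightarrow> fourier_vec L l $ k = fourier_char L (int k * int l)"
  by (simp add: fourier_vec_def fourier_char_def cis_conv_exp algebra_simps)

lemma dft_mat_carrier [simp]: "dft_mat L \<in> carrier_mat L L"
  by (simp add: dft_mat_def)

lemma dft_mat_nth:
  "l < L \<Longrightarrow> k < L \<Longrightarrow> dft_mat L $$ (l, k) = fourier_char L (int k * int l) / of_real (sqrt (real L))"
  by (simp add: dft_mat_def fourier_vec_nth)

lemma dft_mat_unitary:
  assumes "k < L" "l < L"
  shows "(\<Sum>j<L. dft_mat L $$ (k, j) * cnj (dft_mat L $$ (l, j))) = of_bool (k = l)"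
proof -
  have L: "0 < L" using assms by simp
  have sq: "complex_of_real (sqrt (real L)) * complex_of_real (sqrt (real L)) = of_nat L"
    by (simp flip: of_real_mult)
  have "(\<Sum>j<L. dft_mat L $$ (k, j) * cnj (dft_mat L $$ (l, j))) =
      (\<Sum>j<L. fourier_char L ((int k - int l) * int j) / of_nat L)"
  proof (rule sum.cong[OF refl])
    fix j assume "j \<in> {..<L}"
    then show "dft_mat L $$ (k, j) * cnj (dft_mat L $$ (l, j)) =
        fourier_char L ((int k - int l) * int j) / of_nat L"
      using assms by (simp add: dft_mat_nth cnj_fourier_char sq fourier_char_add[symmetric] algebra_simps)
  qed
  also have "\<dots> = (\<Sum>j<L. fourier_char L ((int k - int l) * int j)) / of_nat L"
    by (simp add: sum_divide_distrib)
  also have "\<dots> = of_bool (k = l)"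
  proof -
    have "int L dvd int k - int l \<longleftrightarrow> k = l"
      using assms by (simp add: mod_eq_dvd_iff[symmetric])
    then show ?thesis using L by (simp add: fourier_char_sum)
  qed
  finally show ?thesis .
qed

lemma dft_vec_nth:
  "x \<in> carrier_vec L \<Longrightarrow> k < L \<Longrightarrow> (dft_mat L *\<^sub>v x) $ k = (\<Sum>j<L. dft_mat L $$ (k, j) * x $ j)"
  by (simp add: mult_mat_vec_def scalar_prod_def dft_mat_def atLeast0LessThan)

text \<open>Orthonormality says that the conjugate transpose is a left inverse of the matrix with
  columns \<open>v i\<close>; that matrix is square, so it is a right inverse too. This is where
  having as many vectors as dimensions matters.\<close>

lemma orthonormal_vecs_complete:
  assumes v: "orthonormal_vecs L L v" and kl: "k < L" "l < L"
  shows "(\<Sum>i<L. v i $ k * cnj (v i $ l)) = of_bool (k = l)"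
proof -
  let ?V = "Matrix.mat L L (\<lambda>(k, i). v i $ k)" and ?W = "Matrix.mat L L (\<lambda>(i, k). cnj (v i $ k))"
  have dim: "dim_vec (v i) = L" if "i < L" for i using v that by (auto simp: orthonormal_vecs_def)
  have "?W * ?V = 1\<^sub>m L"
  proof (rule eq_matI)
    fix i j assume "i < dim_row (1\<^sub>m L)" "j < dim_col (1\<^sub>m L)"
    then have ij: "i < L" "j < L" by auto
    have "v j \<bullet>c v i = (if j = i then 1 else 0)" using v ij by (simp add: orthonormal_vecs_def)
    then show "(?W * ?V) $$ (i, j) = 1\<^sub>m L $$ (i, j)"
      using ij by (simp add: scalar_prod_def dim mult.commute)
  qed auto
  then have "?V * ?W = 1\<^sub>m L" by (rule mat_mult_left_right_inverse[rotated 2]) auto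
  then have "(?V * ?W) $$ (k, l) = 1\<^sub>m L $$ (k, l)" by simp
  then show ?thesis using kl by (simp add: scalar_prod_def atLeast0LessThan)
qed

text \<open>The unitary matrix \<open>dft_mat L\<close> carries one resolution of the identity to
  another.\<close>

lemma dft_orthonormal_complete:
  assumes v: "orthonormal_vecs L L v" and kl: "k < L" "l < L"
  shows "(\<Sum>i<L. (dft_mat L *\<^sub>v v i) $ k * cnj ((dft_mat L *\<^sub>v v i) $ l)) = of_bool (k = l)"
proof -
  have vL: "v i \<in> carrier_vec L" if "i < L" for i using v that by (simp add: orthonormal_vecs_def)
  let ?F = "dft_mat L"
  have "(\<Sum>i<L. (?F *\<^sub>v v i) $ k * cnj ((?F *\<^sub>v v i) $ l)) =
      (\<Sum>i<L. \<Sum>j<L. \<Sum>j'<L. ?F $$ (k, j) * cnj (?F $$ (l, j')) * (v i $ j * cnj (v i $ j')))"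
    using kl by (simp add: dft_vec_nth vL sum_product mult_ac)
  also have "\<dots> = (\<Sum>j<L. \<Sum>i<L. \<Sum>j'<L. ?F $$ (k, j) * cnj (?F $$ (l, j')) * (v i $ j * cnj (v i $ j')))"
    by (rule sum.swap)
  also have "\<dots> = (\<Sum>j<L. \<Sum>j'<L. \<Sum>i<L. ?F $$ (k, j) * cnj (?F $$ (l, j')) * (v i $ j * cnj (v i $ j')))"
    by (intro sum.cong refl sum.swap)
  also have "\<dots> = (\<Sum>j<L. \<Sum>j'<L. if j' = j then ?F $$ (k, j) * cnj (?F $$ (l, j')) else 0)"
    by (intro sum.cong refl) (simp add: sum_distrib_left[symmetric] orthonormal_vecs_complete[OF v])
  also have "\<dots> = of_bool (k = l)"
    using dft_mat_unitary[OF kl] by simp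
  finally show ?thesis .
qed

subsection \<open>Positive definiteness\<close>

text \<open>In the coordinates of \<open>u\<close> along the \<open>w i\<close> the form is a sum of
  squares weighted by \<open>lam i\<close>, and by Parseval the unweighted sum is the squared norm
  of \<open>u\<close>.\<close>

lemma spectral_form_lower_bound:
  fixes w :: "nat \<Rightarrow> nat \<Rightarrow> complex" and lam :: "nat \<Rightarrow> real" and u :: "nat \<Rightarrow> complex"
  assumes complete: "\<And>k l. k < L \<Longrightarrow> l < L \<Longrightarrow> (\<Sum>i<L. w i k * cnj (w i l)) = of_bool (k = l)"
    and \<mu>: "\<And>i. i < L \<Longrightarrow> \<mu> \<le> lam i"
  shows "\<mu> * (\<Sum>k<L. (cmod (u k))\<^sup>2) \<le>
    Re (\<Sum>k<L. \<Sum>l<L. (\<Sum>i<L. of_real (lam i) * w i k * cnj (w i l)) * u l * cnj (u k))"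
proof -
  define t where "t i = (\<Sum>k<L. cnj (u k) * w i k)" for i
  \<comment> \<open>General weights serve twice: \<open>lam\<close> gives the form itself, the
    constant 1 gives Parseval.\<close>
  have gen: "(\<Sum>k<L. \<Sum>l<L. (\<Sum>i<L. of_real (c i) * w i k * cnj (w i l)) * u l * cnj (u k)) =
      of_real (\<Sum>i<L. c i * (cmod (t i))\<^sup>2)" for c :: "nat \<Rightarrow> real"
  proof -
    have "(\<Sum>k<L. \<Sum>l<L. (\<Sum>i<L. of_real (c i) * w i k * cnj (w i l)) * u l * cnj (u k)) =
        (\<Sum>k<L. \<Sum>l<L. \<Sum>i<L. of_real (c i) * ((cnj (u k) * w i k) * (u l * cnj (w i l))))"
      by (simp add: sum_distrib_left sum_distrib_right mult_ac)
    also have "\<dots> = (\<Sum>k<L. \<Sum>i<L. \<Sum>l<L. of_real (c i) * ((cnj (u k) * w i k) * (u l * cnj (w i l))))"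
      by (intro sum.cong refl sum.swap)
    also have "\<dots> = (\<Sum>i<L. \<Sum>k<L. \<Sum>l<L. of_real (c i) * ((cnj (u k) * w i k) * (u l * cnj (w i l))))"
      by (rule sum.swap)
    also have "\<dots> = (\<Sum>i<L. of_real (c i) * (t i * cnj (t i)))"
      unfolding t_def cnj_sum sum_product by (simp add: sum_distrib_left)
    finally show ?thesis by (simp only: of_real_sum of_real_mult complex_norm_square)
  qed
  have "of_real (\<Sum>i<L. (cmod (t i))\<^sup>2) = (\<Sum>k<L. \<Sum>l<L. (\<Sum>i<L. w i k * cnj (w i l)) * u l * cnj (u k))"
    using gen[of "\<lambda>_. 1"] by simp
  also have "\<dots> = (\<Sum>k<L. \<Sum>l<L. if l = k then u l * cnj (u k) else 0)"
    by (intro sum.cong refl) (simp add: complete)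
  also have "\<dots> = of_real (\<Sum>k<L. (cmod (u k))\<^sup>2)"
    by (simp add: complex_norm_square del: of_real_power)
  finally have "(\<Sum>k<L. (cmod (u k))\<^sup>2) = (\<Sum>i<L. (cmod (t i))\<^sup>2)"
    by (simp only: of_real_eq_iff)
  then show ?thesis
    unfolding gen by (auto simp: sum_distrib_left intro!: sum_mono mult_right_mono \<mu>)
qed

lemma mat_quadratic_form:
  assumes "X \<in> carrier_mat L L" "u \<in> carrier_vec L"
  shows "(X *\<^sub>v u) \<bullet>c u = (\<Sum>k<L. \<Sum>l<L. X $$ (k, l) * u $ l * cnj (u $ k))"
  using assms by (simp add: scalar_prod_def atLeast0LessThan sum_distrib_right)

lemma hermitian_mat_iff:
  assumes "X \<in> carrier_mat L L"
  shows "hermitian_mat X \<longleftrightarrow> (\<forall>i<L. \<forall>j<L. X $$ (j, i) = cnj (X $$ (i, j)))"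
proof -
  have adj: "mat_adjoint X = Matrix.mat L L (\<lambda>(i, j). cnj (X $$ (j, i)))"
    using assms by (intro eq_matI) (auto simp: mat_adjoint_def mat_of_rows_def)
  show ?thesis
    unfolding hermitian_mat_def
  proof
    assume eq: "mat_adjoint X = X"
    show "\<forall>i<L. \<forall>j<L. X $$ (j, i) = cnj (X $$ (i, j))"
    proof (intro allI impI)
      fix i j assume "i < L" "j < L"
      then have "mat_adjoint X $$ (j, i) = cnj (X $$ (i, j))" by (simp add: adj)
      then show "X $$ (j, i) = cnj (X $$ (i, j))" unfolding eq .
    qed
  next
    assume *: "\<forall>i<L. \<forall>j<L. X $$ (j, i) = cnj (X $$ (i, j))"
    show "mat_adjoint X = X"
    proof (rule eq_matI)
      fix i j assume "i < dim_row X" "j < dim_col X"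
      then have ij: "i < L" "j < L" using assms by auto
      then have "X $$ (i, j) = cnj (X $$ (j, i))" using * by blast
      then show "mat_adjoint X $$ (i, j) = X $$ (i, j)" using ij by (simp add: adj)
    qed (use assms in \<open>simp_all add: adj\<close>)
  qed
qed

text \<open>An entrywise error \<open>\<delta>\<close> changes the quadratic form by at most
  \<open>\<delta> * L\<close> times the squared norm, which is less than the lower bound with
  constant \<open>\<mu>\<close>.\<close>

lemma positive_definite_perturbation:
  fixes S :: "nat \<Rightarrow> nat \<Rightarrow> complex"
  assumes X: "X \<in> carrier_mat L L" and herm: "hermitian_mat X"
    and lower: "\<And>u. \<mu> * (\<Sum>k<L. (cmod (u k))\<^sup>2) \<le> Re (\<Sum>k<L. \<Sum>l<L. S k l * u l * cnj (u k))"
    and close: "\<And>k l. k < L \<Longrightarrow> l < L \<Longrightarrow> cmod (X $$ (k, l) - S k l) \<le> \<delta>"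
    and small: "\<delta> * real L < \<mu>"
  shows "positive_definite_mat L X"
  unfolding positive_definite_mat_def
proof (intro conjI ballI impI X)
  fix u :: "complex vec" assume u: "u \<in> carrier_vec L" and u0: "u \<noteq> 0\<^sub>v L"
  let ?N = "\<Sum>k<L. (cmod (u $ k))\<^sup>2"
  let ?Q = "\<Sum>k<L. \<Sum>l<L. X $$ (k, l) * u $ l * cnj (u $ k)"
  let ?R = "\<Sum>k<L. \<Sum>l<L. S k l * u $ l * cnj (u $ k)"
  obtain k where k: "k < L" "u $ k \<noteq> 0" using u u0 by (auto simp: vec_eq_iff)
  then have "0 < (cmod (u $ k))\<^sup>2" by simp
  also have "\<dots> \<le> ?N" using k by (intro member_le_sum) auto
  finally have N: "0 < ?N" .
  have \<delta>: "0 \<le> \<delta>" by (rule order_trans[OF norm_ge_zero close[OF k(1) k(1)]])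
  \<comment> \<open>Positivity in the order on \<open>complex\<close> includes being real, which the
    Hermitian symmetry supplies.\<close>
  have "cnj ?Q = (\<Sum>k<L. \<Sum>l<L. X $$ (l, k) * cnj (u $ l) * u $ k)"
    unfolding cnj_sum
  proof (intro sum.cong refl)
    fix k l assume "k \<in> {..<L}" "l \<in> {..<L}"
    then have "X $$ (l, k) = cnj (X $$ (k, l))" using herm unfolding hermitian_mat_iff[OF X] by blast
    then show "cnj (X $$ (k, l) * u $ l * cnj (u $ k)) = X $$ (l, k) * cnj (u $ l) * u $ k" by simp
  qed
  also have "\<dots> = (\<Sum>l<L. \<Sum>k<L. X $$ (l, k) * cnj (u $ l) * u $ k)"
    by (rule sum.swap)
  also have "\<dots> = ?Q" by (simp add: mult_ac)
  finally have Im: "Im ?Q = 0" unfolding complex_is_Real_iff[symmetric] Reals_cnj_iff .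
  have "cmod (?Q - ?R) = cmod (\<Sum>k<L. \<Sum>l<L. (X $$ (k, l) - S k l) * u $ l * cnj (u $ k))"
    by (simp add: sum_subtractf[symmetric] algebra_simps)
  also have "\<dots> \<le> (\<Sum>k<L. \<Sum>l<L. \<delta> * cmod (u $ l) * cmod (u $ k))"
    by (intro sum_norm_le) (auto simp: norm_mult intro!: mult_right_mono close)
  also have "\<dots> = \<delta> * (\<Sum>k<L. cmod (u $ k))\<^sup>2"
    by (simp add: power2_eq_square sum_product sum_distrib_left mult_ac)
  \<comment> \<open>Cauchy-Schwarz against the constant vector gives the factor
    \<open>L\<close>.\<close>
  also have "\<dots> \<le> \<delta> * (?N * real L)"
    using sum_squared_le_sum_of_squares[of "\<lambda>k. cmod (u $ k)" "{..<L}"] \<delta>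
    by (intro mult_left_mono) (simp_all add: mult.commute)
  also have "\<dots> < \<mu> * ?N" using mult_strict_right_mono[OF small N] by (simp add: mult_ac)
  finally have "cmod (?Q - ?R) < \<mu> * ?N" .
  moreover have "Re ?R - Re ?Q \<le> cmod (?Q - ?R)"
    using abs_Re_le_cmod[of "?Q - ?R"] by simp
  ultimately have "0 < Re ?Q" using lower[of "\<lambda>k. u $ k"] by linarith
  then show "0 < (X *\<^sub>v u) \<bullet>c u"
    using Im unfolding mat_quadratic_form[OF X u] by (simp add: less_complex_def)
qed

subsection \<open>Spectra of the shifted signal\<close>

lemma dft_signal:
  assumes "\<And>i. i < r \<Longrightarrow> v i \<in> carrier_vec L" "k < L"
  shows "dft L (signal L r v a) \<omega> $ k = (\<Sum>i<r. a i \<omega> * (dft_mat L *\<^sub>v v i) $ k)"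
proof -
  have "dft L (signal L r v a) \<omega> $ k = (\<Sum>j<L. dft_mat L $$ (k, j) * (\<Sum>i<r. a i \<omega> * v i $ j))"
    unfolding dft_def using assms(2) by (subst dft_vec_nth) (auto simp: signal_def)
  also have "\<dots> = (\<Sum>j<L. \<Sum>i<r. a i \<omega> * (dft_mat L $$ (k, j) * v i $ j))"
    by (simp add: sum_distrib_left mult_ac)
  also have "\<dots> = (\<Sum>i<r. \<Sum>j<L. a i \<omega> * (dft_mat L $$ (k, j) * v i $ j))"
    by (rule sum.swap)
  also have "\<dots> = (\<Sum>i<r. a i \<omega> * (dft_mat L *\<^sub>v v i) $ k)"
    by (intro sum.cong refl) (simp add: assms dft_vec_nth sum_distrib_left)
  finally show ?thesis .
qed

lemma zmod_index_less [simp]: "0 < L \<Longrightarrow> zmod_index L i < L"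
  by (simp add: zmod_index_def nat_less_iff)

lemma of_nat_zmod_index: "0 < L \<Longrightarrow> int (zmod_index L i) = i mod int L"
  by (simp add: zmod_index_def)

text \<open>Substituting \<open>l = j + s\<close> modulo \<open>L\<close> pulls out the character at
  \<open>s\<close>, since characters depend on their argument only modulo \<open>L\<close>.\<close>

lemma dft_cyclic_shift:
  assumes x: "x \<in> carrier_vec L" and k: "k < L"
  shows "(dft_mat L *\<^sub>v cyclic_shift L s x) $ k =
    fourier_char L (int k * int s) * (dft_mat L *\<^sub>v x) $ k"
proof -
  have L: "0 < L" using k by simp
  have inv: "zmod_index L (int (zmod_index L (int l - int s)) + int s) = l"
      "zmod_index L (int (zmod_index L (int l + int s)) - int s) = l" if "l < L" for l
    using L that by (simp_all add: zmod_index_def mod_simps)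
  have "(dft_mat L *\<^sub>v cyclic_shift L s x) $ k =
      (\<Sum>l<L. dft_mat L $$ (k, l) * x $ zmod_index L (int l - int s))"
    using k by (subst dft_vec_nth) (auto simp: cyclic_shift_def)
  also have "\<dots> = (\<Sum>j<L. dft_mat L $$ (k, zmod_index L (int j + int s)) * x $ j)"
    by (rule sum.reindex_bij_witness[of _ "\<lambda>j. zmod_index L (int j + int s)" "\<lambda>l. zmod_index L (int l - int s)"])
      (auto simp: L inv)
  also have "\<dots> = (\<Sum>j<L. fourier_char L (int k * int s) * (dft_mat L $$ (k, j) * x $ j))"
  proof (rule sum.cong[OF refl])
    fix j assume j: "j \<in> {..<L}"
    have "fourier_char L (int (zmod_index L (int j + int s)) * int k) = fourier_char L ((int j + int s) * int k)"
      using L by (intro fourier_char_cong) (simp_all add: of_nat_zmod_index mod_simps)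
    then show "dft_mat L $$ (k, zmod_index L (int j + int s)) * x $ j =
        fourier_char L (int k * int s) * (dft_mat L $$ (k, j) * x $ j)"
      using j k L by (simp add: dft_mat_nth fourier_char_add[symmetric] algebra_simps)
  qed
  also have "\<dots> = fourier_char L (int k * int s) * (dft_mat L *\<^sub>v x) $ k"
    by (simp add: dft_vec_nth x k sum_distrib_left)
  finally show ?thesis .
qed

lemma dft_observation:
  "k < L \<Longrightarrow> dft L (observation L r v a s) \<omega> $ k =
    fourier_char L (int k * int (s \<omega>)) * dft L (signal L r v a) \<omega> $ k"
  unfolding dft_def observation_def by (rule dft_cyclic_shift) (simp_all add: signal_def)

lemma power_spectrum_observation:
  assumes "k < L"
  shows "power_spectrum M L (observation L r v a s) k = power_spectrum M L (signal L r v a) k"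
proof -
  have "dft L (observation L r v a s) \<omega> $ k * cnj (dft L (observation L r v a s) \<omega> $ k) =
      dft L (signal L r v a) \<omega> $ k * cnj (dft L (signal L r v a) \<omega> $ k)" for \<omega>
    unfolding complex_norm_square[symmetric] dft_observation[OF assms] norm_mult norm_fourier_char mult_1 ..
  then show ?thesis by (simp add: power_spectrum_def)
qed

text \<open>The fourth frequency balances the other three modulo \<open>L\<close>, so the four shift
  phases multiply to 1 at every \<open>\<omega>\<close>, before any integration.\<close>

lemma trispectrum_observation:
  assumes k: "k1 < L" "k2 < L" "k3 < L"
  shows "trispectrum M L (observation L r v a s) k1 k2 k3 = trispectrum M L (signal L r v a) k1 k2 k3"
proof -
  have L: "0 < L" using k by simp
  define k4 where "k4 = zmod_index L (int k1 - int k2 + int k3)"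
  have k4: "k4 < L" using L by (simp add: k4_def)
  have phase: "fourier_char L (int k1 * int t) * cnj (fourier_char L (int k2 * int t)) *
      fourier_char L (int k3 * int t) * cnj (fourier_char L (int k4 * int t)) = 1" for t
  proof -
    have "fourier_char L (int k4 * int t) = fourier_char L ((int k1 - int k2 + int k3) * int t)"
      using L by (intro fourier_char_cong) (simp_all add: k4_def of_nat_zmod_index mod_simps)
    then show ?thesis
      by (simp add: cnj_fourier_char fourier_char_add[symmetric] algebra_simps)
  qed
  have "dft L (observation L r v a s) \<omega> $ k1 * cnj (dft L (observation L r v a s) \<omega> $ k2) *
      dft L (observation L r v a s) \<omega> $ k3 * cnj (dft L (observation L r v a s) \<omega> $ k4) =
      dft L (signal L r v a) \<omega> $ k1 * cnj (dft L (signal L r v a) \<omega> $ k2) *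
      dft L (signal L r v a) \<omega> $ k3 * cnj (dft L (signal L r v a) \<omega> $ k4)" (is "?lhs = ?rhs") for \<omega>
  proof -
    have "?lhs = (fourier_char L (int k1 * int (s \<omega>)) * cnj (fourier_char L (int k2 * int (s \<omega>))) *
        fourier_char L (int k3 * int (s \<omega>)) * cnj (fourier_char L (int k4 * int (s \<omega>)))) * ?rhs"
      unfolding dft_observation[OF k(1)] dft_observation[OF k(2)] dft_observation[OF k(3)]
        dft_observation[OF k4] by (simp only: complex_cnj_mult mult_ac)
    then show ?thesis by (simp only: phase mult_1)
  qed
  then show ?thesis by (simp add: trispectrum_def k4_def)
qed

subsection \<open>Rotating one pair of cyclic diagonals\<close>

text \<open>\<open>d\<close> is column minus row. Opposite offsets receive conjugate phases for the
  sake of Hermitian symmetry.\<close>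

definition diagonal_phase :: "nat \<Rightarrow> real \<Rightarrow> int \<Rightarrow> complex" where
  "diagonal_phase L \<theta> d =
    (if d mod int L = 1 then cis \<theta> else if (- d) mod int L = 1 then cis (- \<theta>) else 1)"

lemma diagonal_phase_cong:
  assumes "d mod int L = e mod int L"
  shows "diagonal_phase L \<theta> d = diagonal_phase L \<theta> e"
  using assms mod_minus_cong[OF assms] by (simp add: diagonal_phase_def)

lemma norm_diagonal_phase [simp]: "cmod (diagonal_phase L \<theta> d) = 1"
  by (simp add: diagonal_phase_def)

lemma diagonal_phase_0 [simp]: "diagonal_phase L \<theta> 0 = 1"
  by (simp add: diagonal_phase_def)

text \<open>The two rotated offsets 1 and -1 are distinct modulo \<open>L\<close>, since otherwise
  \<open>L\<close> would divide 2; so the branches of the definition exclude each other.\<close>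

lemma diagonal_phase_minus:
  assumes "3 \<le> L"
  shows "diagonal_phase L \<theta> (- d) = cnj (diagonal_phase L \<theta> d)"
proof -
  have "\<not> (d mod int L = 1 \<and> (- d) mod int L = 1)"
  proof
    assume "d mod int L = 1 \<and> (- d) mod int L = 1"
    then have "(d + (- d)) mod int L = (1 + 1) mod int L" by (metis mod_add_eq)
    then show False using assms by simp
  qed
  then show ?thesis by (auto simp: diagonal_phase_def cis_cnj)
qed

lemma norm_diagonal_phase_diff: "cmod (diagonal_phase L \<theta> d - 1) \<le> cmod (cis \<theta> - 1)"
proof -
  have "cmod (cis (- \<theta>) - 1) = cmod (cis \<theta> - 1)"
    by (metis cis_cnj complex_cnj_diff complex_cnj_one complex_mod_cnj)
  then show ?thesis by (simp add: diagonal_phase_def)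
qed

text \<open>The entrywise product of \<open>S\<close> with the circulant matrix of the
  phases.\<close>

definition twist :: "nat \<Rightarrow> real \<Rightarrow> complex mat \<Rightarrow> complex mat" where
  "twist L \<theta> S = Matrix.mat L L (\<lambda>(i, j). diagonal_phase L \<theta> (int j - int i) * S $$ (i, j))"

lemma twist_carrier [simp]: "twist L \<theta> S \<in> carrier_mat L L"
  by (simp add: twist_def)

lemma twist_nth:
  "i < L \<Longrightarrow> j < L \<Longrightarrow> twist L \<theta> S $$ (i, j) = diagonal_phase L \<theta> (int j - int i) * S $$ (i, j)"
  by (simp add: twist_def)

lemma hermitian_twist:
  assumes S: "S \<in> carrier_mat L L" "hermitian_mat S" and L: "3 \<le> L"
  shows "hermitian_mat (twist L \<theta> S)"
  unfolding hermitian_mat_iff[OF twist_carrier]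
proof (intro allI impI)
  fix i j assume ij: "i < L" "j < L"
  have "diagonal_phase L \<theta> (int i - int j) = cnj (diagonal_phase L \<theta> (int j - int i))"
    using diagonal_phase_minus[OF L, of \<theta> "int j - int i"] by simp
  moreover have "S $$ (j, i) = cnj (S $$ (i, j))"
    using S ij hermitian_mat_iff by blast
  ultimately show "twist L \<theta> S $$ (j, i) = cnj (twist L \<theta> S $$ (i, j))"
    using ij by (simp add: twist_nth)
qed

lemma P_map_twist: "k < L \<Longrightarrow> P_map (twist L \<theta> S) k = P_map S k"
  by (simp add: P_map_def twist_nth)

text \<open>Each product in \<^const>\<open>T_map\<close> pairs two entries of the same cyclic diagonal, one of them
  conjugated, so a phase that is constant along cyclic diagonals cancels.\<close>

lemma T_map_twist:
  assumes k: "k1 < L" "k2 < L" "k3 < L"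
  shows "T_map L (twist L \<theta> S) k1 k2 k3 = T_map L S k1 k2 k3"
proof -
  have L: "0 < L" using k by simp
  define k4 where "k4 = zmod_index L (int k3 - int k2 + int k1)"
  have k4: "k4 < L" using L by (simp add: k4_def)
  have unit: "z * cnj z = 1" if "cmod z = 1" for z
    using that by (simp add: complex_norm_square[symmetric] del: of_real_power)
  have pair: "twist L \<theta> S $$ (p, q) * cnj (twist L \<theta> S $$ (p', q')) = S $$ (p, q) * cnj (S $$ (p', q'))"
    if "p < L" "q < L" "p' < L" "q' < L" "(int q - int p) mod int L = (int q' - int p') mod int L"
    for p q p' q'
  proof -
    have "twist L \<theta> S $$ (p, q) * cnj (twist L \<theta> S $$ (p', q')) =
        (diagonal_phase L \<theta> (int q - int p) * cnj (diagonal_phase L \<theta> (int q - int p))) *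
        (S $$ (p, q) * cnj (S $$ (p', q')))"
      using that diagonal_phase_cong[OF that(5), of \<theta>] by (simp add: twist_nth)
    then show ?thesis by (simp add: unit)
  qed
  \<comment> \<open>Both congruences restate \<open>k1 + k3 = k2 + k4\<close> modulo
    \<open>L\<close>.\<close>
  have "(int k2 - int k1) mod int L = (int k3 - int k4) mod int L"
    "(int k4 - int k1) mod int L = (int k3 - int k2) mod int L"
    using L by (simp_all add: k4_def of_nat_zmod_index mod_simps)
  then show ?thesis
    using pair[OF k(1,2) k4 k(3)] pair[OF k(1) k4 k(2,3)] by (simp add: T_map_def k4_def)
qed

section \<open>Choosing an angle that leaves the ambiguity set\<close>

text \<open>A member of the ambiguity set has entry (0, 1) multiplied by an \<open>L\<close>-th root
  of unity, the twist has it multiplied by \<open>cis \<theta>\<close>. As this entry is nonzero,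
  \<open>L * \<theta>\<close> would be a multiple of \<open>2 * pi\<close> strictly between 0 and
  \<open>2 * pi\<close>.\<close>

lemma twist_notin_ambiguity_set:
  assumes S: "S \<in> carrier_mat L L" and S01: "S $$ (0, 1) \<noteq> 0" and L: "2 \<le> L"
    and \<theta>: "0 < \<theta>" "real L * \<theta> < 2 * pi"
  shows "twist L \<theta> S \<notin> ambiguity_set L S"
proof
  assume "twist L \<theta> S \<in> ambiguity_set L S"
  then obtain l where eq: "twist L \<theta> S =
      mat_diag L (\<lambda>k. fourier_vec L l $ k) * S * mat_diag L (\<lambda>k. cnj (fourier_vec L l $ k))"
    unfolding ambiguity_set_def by blast
  have "(mat_diag L (\<lambda>k. fourier_vec L l $ k) * S * mat_diag L (\<lambda>k. cnj (fourier_vec L l $ k))) $$ (0, 1) =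
      fourier_vec L l $ 0 * S $$ (0, 1) * cnj (fourier_vec L l $ 1)"
    using S L by (simp add: mat_diag_mult_left[OF S] mat_diag_mult_right[of _ L])
  then have "diagonal_phase L \<theta> 1 * S $$ (0, 1) = fourier_char L (- int l) * S $$ (0, 1)"
    unfolding eq[symmetric] using L by (simp add: twist_nth fourier_vec_nth cnj_fourier_char)
  then have "cis \<theta> = fourier_char L (- int l)"
    using S01 L by (simp add: diagonal_phase_def)
  then have "cis \<theta> ^ L = 1"
    using L fourier_char_period[of L "- int l"] by (simp add: fourier_char_mult_of_nat[symmetric] mult.commute)
  then have "cos (real L * \<theta>) = 1"
    unfolding Complex.DeMoivre by (simp add: complex_eq_iff)
  then obtain q :: int where q: "real L * \<theta> = of_int q * 2 * pi"
    unfolding cos_one_2pi_int by blast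
  have "0 < real L * \<theta>" using L \<theta>(1) by simp
  then have "0 < q" unfolding q by (simp add: zero_less_mult_iff)
  moreover have "q < 1" using \<theta>(2) unfolding q by simp
  ultimately show False by simp
qed

lemma small_rotation:
  assumes "0 < (\<delta>::real)" "0 < (\<beta>::real)"
  obtains \<theta> where "0 < \<theta>" "\<theta> < \<beta>" "cmod (cis \<theta> - 1) < \<delta>"
proof -
  have "(cis \<longlongrightarrow> cis 0) (at (0::real))" by (intro tendsto_cis tendsto_ident_at)
  then obtain e where e: "0 < e" "\<And>x. x \<noteq> 0 \<Longrightarrow> dist x 0 < e \<Longrightarrow> dist (cis x) (cis 0) < \<delta>"
    using assms(1) unfolding tendsto_iff eventually_at by blast
  show ?thesis
    \<comment> \<open>Halving makes both bounds strict while keeping the angle positive.\<close>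
    using e(2)[of "min (e / 2) (\<beta> / 2)"] e(1) assms(2)
    by (intro that[of "min (e / 2) (\<beta> / 2)"]) (auto simp: dist_norm min_def split: if_splits)
qed

section \<open>Non-identifiability of a full-rank Fourier covariance\<close>

theorem proposition6:
  fixes M :: "'w measure"
    and L r :: nat
    and v :: "nat \<Rightarrow> complex vec"
    and lam :: "nat \<Rightarrow> real"
    and a :: "nat \<Rightarrow> 'w \<Rightarrow> complex"
    and s :: "'w \<Rightarrow> nat"
  assumes model: "mra_model M L r v lam a s"
    and L3: "3 \<le> L"
    and nonzero: "\<And>i j. i < L \<Longrightarrow> j < L \<Longrightarrow> fourier_cov M L (signal L r v a) $$ (i, j) \<noteq> 0"
    and full_rank: "r = L"
  shows "\<exists>X \<in> carrier_mat L L.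
           hermitian_mat X \<and> positive_definite_mat L X \<and>
           X \<notin> ambiguity_set L (fourier_cov M L (signal L r v a)) \<and>
           (\<forall>k<L. power_spectrum M L (observation L r v a s) k = P_map X k) \<and>
           (\<forall>k1<L. \<forall>k2<L. \<forall>k3<L. trispectrum M L (observation L r v a s) k1 k2 k3 =
             T_map L X k1 k2 k3)"
proof -
  interpret mra_model M L r v lam a s by (rule model)
  \<comment> \<open>\<open>w i\<close> is the Fourier transform of \<open>v i\<close>, and
    \<open>C\<close> is the spectral expression for the covariance entries.\<close>
  define w where "w i k = (dft_mat L *\<^sub>v v i) $ k" for i k
  define C where "C k l = (\<Sum>i<r. of_real (lam i) * w i k * cnj (w i l))" for k l
  define S where "S = fourier_cov M L (signal L r v a)"
  have v: "v i \<in> carrier_vec L" if "i < r" for i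
    using orthonormal that by (simp add: orthonormal_vecs_def)
  have sig: "dft L (signal L r v a) \<omega> $ k = (\<Sum>i<r. a i \<omega> * w i k)" if "k < L" for \<omega> k
    using dft_signal[OF v that, where r = r] by (simp add: w_def)
  have Wick: "expectation (\<lambda>\<omega>. (\<Sum>i<r. a i \<omega> * b i) * cnj (\<Sum>i<r. a i \<omega> * c i)) =
        (\<Sum>i<r. of_real (lam i) * b i * cnj (c i))"
      "expectation (\<lambda>\<omega>. (\<Sum>i<r. a i \<omega> * b i) * cnj (\<Sum>i<r. a i \<omega> * c i) *
          (\<Sum>i<r. a i \<omega> * d i) * cnj (\<Sum>i<r. a i \<omega> * e i)) =
        (\<Sum>i<r. of_real (lam i) * b i * cnj (c i)) * (\<Sum>i<r. of_real (lam i) * d i * cnj (e i)) +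
        (\<Sum>i<r. of_real (lam i) * b i * cnj (e i)) * (\<Sum>i<r. of_real (lam i) * d i * cnj (c i))"
    for b c d e :: "nat \<Rightarrow> complex"
    by (rule circular_normal_Wick[OF finite_lessThan coeff_indep];
        simp add: coeff_normal lam_pos)+
  have S: "S \<in> carrier_mat L L" by (simp add: S_def fourier_cov_def)
  have S_nth: "S $$ (k, l) = C k l" if "k < L" "l < L" for k l
  proof -
    have "S $$ (k, l) =
        expectation (\<lambda>\<omega>. dft L (signal L r v a) \<omega> $ k * cnj (dft L (signal L r v a) \<omega> $ l))"
      using that by (simp add: S_def fourier_cov_def)
    then show ?thesis unfolding sig[OF that(1)] sig[OF that(2)] Wick(1) C_def .
  qed
  have C_cnj: "C l k = cnj (C k l)" for k l by (simp add: C_def mult_ac)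
  have herm: "hermitian_mat S"
    unfolding hermitian_mat_iff[OF S]
  proof (intro allI impI)
    fix i j assume "i < L" "j < L"
    then show "S $$ (j, i) = cnj (S $$ (i, j))" by (simp add: S_nth C_cnj[of j i])
  qed
  have P: "power_spectrum M L (observation L r v a s) k = P_map S k" if "k < L" for k
    unfolding power_spectrum_observation[OF that] using that
    by (simp add: P_map_def power_spectrum_def S_def fourier_cov_def)
  have T: "trispectrum M L (observation L r v a s) k1 k2 k3 = T_map L S k1 k2 k3"
    if k: "k1 < L" "k2 < L" "k3 < L" for k1 k2 k3
  proof -
    define k4 where "k4 = zmod_index L (int k1 - int k2 + int k3)"
    have k4: "k4 < L" and k4': "zmod_index L (int k3 - int k2 + int k1) = k4"
      using k by (simp_all add: k4_def algebra_simps)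
    have "trispectrum M L (observation L r v a s) k1 k2 k3 = C k1 k2 * C k3 k4 + C k1 k4 * C k3 k2"
      unfolding trispectrum_observation[OF k]
      unfolding trispectrum_def k4_def[symmetric] sig[OF k(1)] sig[OF k(2)] sig[OF k(3)] sig[OF k4] Wick(2) C_def by (rule refl)
    \<comment> \<open>Wick's formula yields \<open>C k3 k4\<close> and \<open>C k3 k2\<close>,
      whereas \<open>T_map\<close> conjugates the transposed entries; Hermitian symmetry identifies
      them.\<close>
    then show ?thesis
      unfolding T_map_def k4' using k k4 by (simp add: S_nth C_cnj[of k3 k4] C_cnj[of k3 k2])
  qed
  \<comment> \<open>The smallest eigenvalue: with \<open>r = L\<close> every \<open>lam i\<close>
    for \<open>i < L\<close> is an eigenvalue and positive.\<close>
  define \<mu> where "\<mu> = Min (lam ` {..<L})"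
  have ne: "lam ` {..<L} \<noteq> {}" using L3 by (auto simp: lessThan_empty_iff)
  have \<mu>: "0 < \<mu>" "\<And>i. i < L \<Longrightarrow> \<mu> \<le> lam i"
    using ne lam_pos by (auto simp: \<mu>_def full_rank)
  \<comment> \<open>A common bound for all entries; adding 1 makes it positive, so that dividing by
    \<open>B * L\<close> is safe.\<close>
  define B where "B = (\<Sum>k<L. \<Sum>l<L. cmod (C k l)) + 1"
  have B: "cmod (C k l) \<le> B" if "k < L" "l < L" for k l
  proof -
    have "cmod (C k l) \<le> (\<Sum>l<L. cmod (C k l))" using that by (intro member_le_sum) auto
    also have "\<dots> \<le> (\<Sum>k<L. \<Sum>l<L. cmod (C k l))"
      using that by (intro member_le_sum[of k _ "\<lambda>k. \<Sum>l<L. cmod (C k l)"]) (auto intro: sum_nonneg)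
    finally show ?thesis by (simp add: B_def)
  qed
  have B0: "0 < B" unfolding B_def by (intro add_nonneg_pos sum_nonneg) auto
  \<comment> \<open>The first upper bound keeps \<open>cis \<theta>\<close> from being an
    \<open>L\<close>-th root of unity. The second keeps the entrywise error, at most
    \<open>cmod (cis \<theta> - 1) * B\<close>, below \<open>\<mu> / L\<close>.\<close>
  obtain \<theta> where \<theta>: "0 < \<theta>" "\<theta> < 2 * pi / real L" "cmod (cis \<theta> - 1) < \<mu> / (B * real L)"
    using small_rotation[of "\<mu> / (B * real L)" "2 * pi / real L"] \<mu>(1) B0 L3 by auto
  let ?X = "twist L \<theta> S"
  have "positive_definite_mat L ?X"
  proof (rule positive_definite_perturbation[OF twist_carrier hermitian_twist[OF S herm L3]])
    show "\<mu> * (\<Sum>k<L. (cmod (u k))\<^sup>2) \<le> Re (\<Sum>k<L. \<Sum>l<L. C k l * u l * cnj (u k))" for u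
      \<comment> \<open>With \<open>r = L\<close> the transformed vectors resolve the identity, so
        the spectral bound applies with eigenvalues \<open>lam\<close>.\<close>
      unfolding C_def full_rank using dft_orthonormal_complete[of L v] orthonormal \<mu>(2)
      by (intro spectral_form_lower_bound) (auto simp: w_def full_rank)
    show "cmod (?X $$ (k, l) - C k l) \<le> cmod (cis \<theta> - 1) * B" if "k < L" "l < L" for k l
    proof -
      have "?X $$ (k, l) - C k l = (diagonal_phase L \<theta> (int l - int k) - 1) * C k l"
        using that by (simp add: twist_nth S_nth algebra_simps)
      then show ?thesis
        using norm_diagonal_phase_diff B[OF that] by (simp add: norm_mult mult_mono)
    qed
    show "cmod (cis \<theta> - 1) * B * real L < \<mu>"
      using \<theta>(3) B0 L3 by (simp add: pos_less_divide_eq mult_ac)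
  qed
  moreover have "?X \<notin> ambiguity_set L S"
    using \<theta> L3 nonzero[of 0 1] by (intro twist_notin_ambiguity_set[OF S]) (auto simp: S_def field_simps)
  ultimately show ?thesis
    using hermitian_twist[OF S herm L3] P T
    by (intro bexI[of _ ?X]) (auto simp: P_map_twist T_map_twist S_def[symmetric])
qed

end
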